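(* For every one-parameter semigroup $\{\phi_t\}_{t\ge0}$ of analytic self-maps of the unit disk $\mathbb{D}$, the disk algebra $A$ satisfies $A\subset[\phi_t,H^\infty]$.
   Context: $\mathbb{D}=\{z\in\mathbb{C}:|z|<1\}$, $H(\mathbb{D})$ is the set of analytic functions on $\mathbb{D}$, and $H^\infty$ is the space of bounded functions in $H(\mathbb{D})$ with norm $\|f\|_\infty=\sup_{z\in\mathbb{D}}|f(z)|$. The disk algebra $A$ is the subspace of $H^\infty$ consisting of functions that extend to be continuous on $\overline{\mathbb{D}}$. A one-parameter semigroup $\{\phi_t\}_{t\ge0}$ of analytic functions on $\mathbb{D}$ is a family of analytic functions $\phi_t:\mathbb{D}\to\mathbb{D}$ such that: $\phi_0(z)=z$ for $z\in\mathbb{D}$; $\phi_{s+t}=\phi_s\circ\phi_t$ for all $s,t\ge0$; and $(t,z)\mapsto\phi_t(z)$ is continuous on $[0,\infty)\times\mathbb{D}$. Put $C_t(f)=f\circ\phi_t$. $[\phi_t,H^\infty]$ denotes the maximal closed subspace of $H^\infty$ on which $\{C_t\}$ is strongly continuous, i.e. on which $\lim_{t\to0^+}\|f\circ\phi_t-f\|_\infty=0$ for every element $f$. *)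

theory Defs
  imports "HOL-Complex_Analysis.Complex_Analysis"
begin

text \<open>
  Functions on the unit disc are represented by total functions of type
  \<open>complex \<Rightarrow> complex\<close>, of which only the values on the disc matter.
\<close>

abbreviation unit_disc :: "complex set" where
  "unit_disc \<equiv> ball 0 1"

definition Hinf :: "(complex \<Rightarrow> complex) set" where
  "Hinf = {f. f holomorphic_on unit_disc \<and> bounded (f ` unit_disc)}"

definition Hinf_norm :: "(complex \<Rightarrow> complex) \<Rightarrow> real" where
  "Hinf_norm f = (SUP z\<in>unit_disc. norm (f z))"

definition disc_algebra :: "(complex \<Rightarrow> complex) set" where
  "disc_algebra =
     {f \<in> Hinf. \<exists>g. continuous_on (closure unit_disc) g \<and> (\<forall>z\<in>unit_disc. g z = f z)}"

text \<open>
  The index \<open>t\<close> ranges over all reals only for typing reasons; nothing is required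
  of \<open>\<phi> t\<close> for \<open>t < 0\<close>.
\<close>

definition holomorphic_semigroup :: "(real \<Rightarrow> complex \<Rightarrow> complex) \<Rightarrow> bool" where
  "holomorphic_semigroup \<phi> \<longleftrightarrow>
     (\<forall>t\<ge>0. \<phi> t holomorphic_on unit_disc \<and> \<phi> t ` unit_disc \<subseteq> unit_disc) \<and>
     (\<forall>z\<in>unit_disc. \<phi> 0 z = z) \<and>
     (\<forall>s\<ge>0. \<forall>t\<ge>0. \<forall>z\<in>unit_disc. \<phi> (s + t) z = (\<phi> s \<circ> \<phi> t) z) \<and>
     continuous_on ({0..} \<times> unit_disc) (\<lambda>(t, z). \<phi> t z)"

definition comp_op :: "(real \<Rightarrow> complex \<Rightarrow> complex) \<Rightarrow> real \<Rightarrow> (complex \<Rightarrow> complex) \<Rightarrow> complex \<Rightarrow> complex" where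
  "comp_op \<phi> t f = f \<circ> \<phi> t"

text \<open>
  Since \<^const>\<open>Hinf_norm\<close> ignores values off the disc, the last clause also makes
  a closed subspace invariant under changing its elements off the disc.
\<close>

definition closed_subspace_Hinf :: "(complex \<Rightarrow> complex) set \<Rightarrow> bool" where
  "closed_subspace_Hinf X \<longleftrightarrow>
     X \<subseteq> Hinf \<and>
     (\<lambda>z. 0) \<in> X \<and>
     (\<forall>f\<in>X. \<forall>g\<in>X. (\<lambda>z. f z + g z) \<in> X) \<and>
     (\<forall>c. \<forall>f\<in>X. (\<lambda>z. c * f z) \<in> X) \<and>
     (\<forall>F. \<forall>f\<in>Hinf. (\<forall>n::nat. F n \<in> X) \<longrightarrow>
        (\<lambda>n. Hinf_norm (\<lambda>z. F n z - f z)) \<longlonglongrightarrow> 0 \<longrightarrow> f \<in> X)"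

definition strongly_continuous_on ::
    "(real \<Rightarrow> complex \<Rightarrow> complex) \<Rightarrow> (complex \<Rightarrow> complex) set \<Rightarrow> bool" where
  "strongly_continuous_on \<phi> X \<longleftrightarrow>
     (\<forall>f\<in>X. ((\<lambda>t. Hinf_norm (\<lambda>z. comp_op \<phi> t f z - f z)) \<longlongrightarrow> 0) (at_right 0))"

text \<open>
  The space \<open>[\<phi>\<^sub>t, H\<^sup>\<infinity>]\<close>; the order on sets is inclusion, so this is the largest closed
  subspace on which the semigroup is strongly continuous. That it exists is shown in
  \<open>maximal_subspace_greatest\<close> below.
\<close>

definition maximal_subspace :: "(real \<Rightarrow> complex \<Rightarrow> complex) \<Rightarrow> (complex \<Rightarrow> complex) set" where
  "maximal_subspace \<phi> = (GREATEST X. closed_subspace_Hinf X \<and> strongly_continuous_on \<phi> X)"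

lemma Hinf_norm_upper:
  assumes "f \<in> Hinf" "z \<in> unit_disc"
  shows "norm (f z) \<le> Hinf_norm f"
proof -
  have "bdd_above ((\<lambda>z. norm (f z)) ` unit_disc)"
    using assms(1) unfolding Hinf_def bounded_iff bdd_above_def by auto
  then show ?thesis
    unfolding Hinf_norm_def using assms(2) by (rule cSUP_upper[rotated])
qed

lemma Hinf_norm_least:
  assumes "\<And>z. z \<in> unit_disc \<Longrightarrow> norm (f z) \<le> B"
  shows "Hinf_norm f \<le> B"
  unfolding Hinf_norm_def by (rule cSUP_least) (use assms in auto)

lemma Hinf_norm_nonneg: "f \<in> Hinf \<Longrightarrow> 0 \<le> Hinf_norm f"
  by (rule order_trans[OF norm_ge_zero Hinf_norm_upper[of f 0]]) auto

lemma Hinf_zero: "(\<lambda>z. 0) \<in> Hinf"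
  by (auto simp: Hinf_def bounded_iff)

lemma Hinf_add:
  assumes "f \<in> Hinf" "g \<in> Hinf" shows "(\<lambda>z. f z + g z) \<in> Hinf"
  using assms unfolding Hinf_def
  by (auto intro!: holomorphic_intros bounded_plus_comp)

lemma Hinf_scale:
  assumes "f \<in> Hinf" shows "(\<lambda>z. c * f z) \<in> Hinf"
proof -
  obtain B where "\<And>z. z \<in> unit_disc \<Longrightarrow> norm (f z) \<le> B"
    using assms unfolding Hinf_def bounded_iff by blast
  then have "\<And>z. z \<in> unit_disc \<Longrightarrow> norm (c * f z) \<le> norm c * B"
    by (simp add: norm_mult mult_left_mono)
  then have "bounded ((\<lambda>z. c * f z) ` unit_disc)"
    unfolding bounded_iff by blast
  then show ?thesis
    using assms by (auto simp: Hinf_def intro!: holomorphic_intros)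
qed

lemma Hinf_diff:
  assumes "f \<in> Hinf" "g \<in> Hinf" shows "(\<lambda>z. f z - g z) \<in> Hinf"
  using Hinf_add[OF assms(1) Hinf_scale[OF assms(2), of "-1"]] by simp

lemma comp_op_Hinf:
  assumes "holomorphic_semigroup \<phi>" "t \<ge> 0" "f \<in> Hinf"
  shows "comp_op \<phi> t f \<in> Hinf"
proof -
  have h: "\<phi> t holomorphic_on unit_disc" "\<phi> t ` unit_disc \<subseteq> unit_disc"
    using assms unfolding holomorphic_semigroup_def by auto
  have "f \<circ> \<phi> t holomorphic_on unit_disc"
    using h assms(3) unfolding Hinf_def by (auto intro: holomorphic_on_compose_gen)
  moreover have "bounded ((f \<circ> \<phi> t) ` unit_disc)"
    using h(2) assms(3) unfolding Hinf_def image_comp[symmetric]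
    by (auto intro: bounded_subset image_mono)
  ultimately show ?thesis
    by (simp add: Hinf_def comp_op_def)
qed

lemma maximal_subspace_greatest:
  assumes "holomorphic_semigroup \<phi>"
  shows "closed_subspace_Hinf (maximal_subspace \<phi>)"
    and "strongly_continuous_on \<phi> (maximal_subspace \<phi>)"
    and "\<And>X. closed_subspace_Hinf X \<Longrightarrow> strongly_continuous_on \<phi> X \<Longrightarrow> X \<subseteq> maximal_subspace \<phi>"
proof -
  define N where "N f t = Hinf_norm (\<lambda>z. comp_op \<phi> t f z - f z)" for f t
  define M where "M = {f \<in> Hinf. (N f \<longlongrightarrow> 0) (at_right 0)}"
  have dH: "(\<lambda>z. comp_op \<phi> t f z - f z) \<in> Hinf" if "f \<in> Hinf" "t \<ge> 0" for f t
    using that assms by (intro Hinf_diff comp_op_Hinf)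
  have N0: "0 \<le> N f t" if "f \<in> Hinf" "t \<ge> 0" for f t
    unfolding N_def by (rule Hinf_norm_nonneg[OF dH[OF that]])
  have Nz: "norm (f (\<phi> t z) - f z) \<le> N f t" if "f \<in> Hinf" "t \<ge> 0" "z \<in> unit_disc" for f t z
    using Hinf_norm_upper[OF dH[OF that(1,2)] that(3)] by (simp add: N_def comp_op_def)
  have Nle: "N f t \<le> B" if "\<And>z. z \<in> unit_disc \<Longrightarrow> norm (f (\<phi> t z) - f z) \<le> B" for f t B
    unfolding N_def by (rule Hinf_norm_least) (use that in \<open>simp add: comp_op_def\<close>)
  have memI: "f \<in> M" if "f \<in> Hinf" and "(u \<longlongrightarrow> 0) (at_right 0)" and "\<And>t. t \<ge> 0 \<Longrightarrow> N f t \<le> u t" for f u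
  proof -
    have lo: "\<forall>\<^sub>F t in at_right 0. 0 \<le> N f t"
      using eventually_at_right_less[of 0]
      by (rule eventually_mono) (rule N0[OF that(1)], simp)
    have up: "\<forall>\<^sub>F t in at_right 0. N f t \<le> u t"
      using eventually_at_right_less[of 0]
      by (rule eventually_mono) (rule that(3), simp)
    have "(N f \<longlongrightarrow> 0) (at_right 0)"
      by (rule tendsto_sandwich[OF lo up tendsto_const that(2)])
    then show ?thesis using that(1) by (simp add: M_def)
  qed
  have cs: "closed_subspace_Hinf M"
    unfolding closed_subspace_Hinf_def
  proof (intro conjI ballI allI impI)
    show "M \<subseteq> Hinf" by (auto simp: M_def)
    show "(\<lambda>z. 0) \<in> M"
      by (rule memI[OF Hinf_zero tendsto_const]) (auto intro: Nle)
  next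
    fix f g assume fg: "f \<in> M" "g \<in> M"
    then have H: "f \<in> Hinf" "g \<in> Hinf" by (auto simp: M_def)
    have "((\<lambda>t. N f t + N g t) \<longlongrightarrow> 0) (at_right 0)"
      using fg by (auto simp: M_def intro: tendsto_add_zero)
    then show "(\<lambda>z. f z + g z) \<in> M"
    proof (rule memI[OF Hinf_add[OF H]])
      fix t :: real assume t: "t \<ge> 0"
      show "N (\<lambda>z. f z + g z) t \<le> N f t + N g t"
      proof (rule Nle)
        fix z assume z: "z \<in> unit_disc"
        have "norm (f (\<phi> t z) + g (\<phi> t z) - (f z + g z))
              \<le> norm (f (\<phi> t z) - f z) + norm (g (\<phi> t z) - g z)"
          by (rule norm_diff_triangle_ineq)
        then show "norm (f (\<phi> t z) + g (\<phi> t z) - (f z + g z)) \<le> N f t + N g t"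
          using Nz[OF H(1) t z] Nz[OF H(2) t z] by linarith
      qed
    qed
  next
    fix c :: complex and f assume f: "f \<in> M"
    then have H: "f \<in> Hinf" by (auto simp: M_def)
    have "((\<lambda>t. norm c * N f t) \<longlongrightarrow> 0) (at_right 0)"
      using f by (auto simp: M_def intro: tendsto_mult_right_zero)
    then show "(\<lambda>z. c * f z) \<in> M"
    proof (rule memI[OF Hinf_scale[OF H]])
      fix t :: real assume t: "t \<ge> 0"
      show "N (\<lambda>z. c * f z) t \<le> norm c * N f t"
        by (rule Nle)
           (simp add: right_diff_distrib[symmetric] norm_mult mult_left_mono Nz[OF H t])
    qed
  next
    fix F f assume f: "f \<in> Hinf" and F: "\<forall>n::nat. F n \<in> M"
      and lim: "(\<lambda>n. Hinf_norm (\<lambda>z. F n z - f z)) \<longlonglongrightarrow> 0"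
    have FH: "F n \<in> Hinf" for n using F by (auto simp: M_def)
    have "(N f \<longlongrightarrow> 0) (at_right 0)"
    proof (rule tendstoI)
      fix e :: real assume e: "e > 0"
      then obtain n where n: "Hinf_norm (\<lambda>z. F n z - f z) < e / 4"
        using order_tendstoD(2)[OF lim, of "e / 4"] by (auto simp: eventually_sequentially)
      have "\<forall>\<^sub>F t in at_right 0. N (F n) t < e / 4"
        using F e by (intro order_tendstoD(2)[of _ 0]) (auto simp: M_def)
      then show "\<forall>\<^sub>F t in at_right 0. dist (N f t) 0 < e"
        using eventually_at_right_less[of 0]
      proof eventually_elim
        case (elim t)
        then have t: "t \<ge> 0" by simp
        have "N f t \<le> 3 * (e / 4)"
        proof (rule Nle)
          fix z assume z: "z \<in> unit_disc"
          have pz: "\<phi> t z \<in> unit_disc"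
            using assms t z unfolding holomorphic_semigroup_def by blast
          have 1: "norm (F n w - f w) < e / 4" if "w \<in> unit_disc" for w
            using Hinf_norm_upper[OF Hinf_diff[OF FH f] that] n by (rule le_less_trans)
          have 2: "norm (F n (\<phi> t z) - F n z) < e / 4"
            using Nz[OF FH t z] elim(1) by (rule le_less_trans)
          have "f (\<phi> t z) - f z =
                (F n (\<phi> t z) - F n z) - (F n (\<phi> t z) - f (\<phi> t z)) + (F n z - f z)"
            by simp
          also have "norm \<dots> \<le> norm (F n (\<phi> t z) - F n z) + norm (F n (\<phi> t z) - f (\<phi> t z))
                              + norm (F n z - f z)"
            by (meson add_right_mono norm_triangle_ineq norm_triangle_ineq4 order_trans)
          finally show "norm (f (\<phi> t z) - f z) \<le> 3 * (e / 4)"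
            using 1[OF z] 1[OF pz] 2 by linarith
        qed
        then show ?case using N0[OF f t] e by simp
      qed
    qed
    then show "f \<in> M" using f by (simp add: M_def)
  qed
  have sc: "strongly_continuous_on \<phi> M"
    by (auto simp: strongly_continuous_on_def M_def N_def[abs_def])
  have gr: "X \<subseteq> M" if "closed_subspace_Hinf X" "strongly_continuous_on \<phi> X" for X
    using that by (auto simp: strongly_continuous_on_def closed_subspace_Hinf_def M_def N_def[abs_def])
  have "maximal_subspace \<phi> = M"
    unfolding maximal_subspace_def by (rule Greatest_equality) (use cs sc gr in auto)
  then show "closed_subspace_Hinf (maximal_subspace \<phi>)"
    and "strongly_continuous_on \<phi> (maximal_subspace \<phi>)"
    and "\<And>X. closed_subspace_Hinf X \<Longrightarrow> strongly_continuous_on \<phi> X \<Longrightarrow> X \<subseteq> maximal_subspace \<phi>"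
    using cs sc gr by auto
qed

end

theory Submission
  imports Defs
begin

text \<open>
  The point is that \<open>\<phi>\<^sub>t\<close> tends to the identity uniformly on the whole disc. The function
  \<open>A z = \<integral>\<^sub>0\<^sup>d \<phi>\<^sub>s(z) ds\<close> is bounded and holomorphic, it is nonconstant for small \<open>d\<close> because
  it is then close to \<open>d z\<close>, and it moves little along orbits: \<open>\<bar>A(\<phi>\<^sub>t(z)) - A z\<bar> \<le> 2 t\<close>. If orbit
  arcs \<open>{\<phi>\<^sub>s(z). s \<le> t}\<close> of diameter bounded below existed for arbitrarily small \<open>t\<close>, they would leave
  every compact part of the disc, so they would form a Koebe sequence of arcs on which \<open>A\<close> is
  asymptotically constant. The classical theorem of Koebe forbids this for a nonconstant bounded \<open>A\<close>.
\<close>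

subsection \<open>Koebe's theorem on arcs\<close>

text \<open>Maximum principle: if the component of the open set \<open>S\<close> around the origin
  stayed in \<open>cball 0 R\<close>, its frontier would lie in the frontier of \<open>S\<close>,
  where the modulus is at most \<open>B\<close>, and so the value at the origin would be at most
  \<open>B\<close> too. An open connected set is path connected, which yields the path.\<close>

lemma superlevel_path:
  fixes G :: "complex \<Rightarrow> complex"
  assumes holG: "G holomorphic_on ball 0 1" and B: "B < norm (G 0)" and R: "0 < R" "R < 1"
  obtains \<sigma> where "path \<sigma>" "path_image \<sigma> \<subseteq> ball 0 1" "pathstart \<sigma> = 0"
    "R \<le> norm (pathfinish \<sigma>)" "\<And>w. w \<in> path_image \<sigma> \<Longrightarrow> B < norm (G w)"
proof -
  define S where "S = {z \<in> ball 0 1. B < norm (G z)}"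
  define C where "C = connected_component_set S 0"
  have contG: "continuous_on (ball 0 1) G"
    using holG by (rule holomorphic_on_imp_continuous_on)
  have "open ((\<lambda>z. norm (G z)) -` {B<..} \<inter> ball 0 1)"
    by (rule continuous_on_open_vimage[THEN iffD1, rule_format])
       (use contG in \<open>auto intro: continuous_intros\<close>)
  moreover have "S = (\<lambda>z. norm (G z)) -` {B<..} \<inter> ball 0 1"
    by (auto simp: S_def)
  ultimately have "open S" by simp
  then have "open C" unfolding C_def by (rule open_connected_component)
  have "0 \<in> S" using B by (simp add: S_def)
  then have "0 \<in> C" by (simp add: C_def)
  have CS: "C \<subseteq> S" unfolding C_def by (rule connected_component_subset)
  have "\<exists>w\<in>C. R \<le> norm w"
  proof (rule ccontr)
    assume "\<not> ?thesis"
    then have sub: "C \<subseteq> cball 0 R" by force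
    then have cl: "closure C \<subseteq> cball 0 R" by (simp add: closure_minimal)
    also have disc: "\<dots> \<subseteq> ball 0 1" using R by auto
    finally have clD: "closure C \<subseteq> ball 0 1" .
    have "norm (G 0) \<le> B"
    proof (rule maximum_modulus_frontier[of G C])
      show "G holomorphic_on interior C"
        using holG by (rule holomorphic_on_subset) (use CS interior_subset[of C] in \<open>auto simp: S_def\<close>)
      show "continuous_on (closure C) G"
        using contG clD by (rule continuous_on_subset)
      show "bounded C" using bounded_cball sub by (rule bounded_subset)
      show "norm (G z) \<le> B" if z: "z \<in> frontier C" for z
      proof (rule ccontr)
        assume "\<not> norm (G z) \<le> B"
        moreover have "z \<in> ball 0 1" using z clD by (auto simp: frontier_def)
        ultimately have "z \<in> S" by (simp add: S_def)
        moreover have "z \<in> frontier S"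
          using z frontier_of_connected_component_subset unfolding C_def by blast
        ultimately show False using \<open>open S\<close> by (simp add: frontier_def interior_open)
      qed
    qed (rule \<open>0 \<in> C\<close>)
    then show False using B by simp
  qed
  then obtain w where w: "w \<in> C" "R \<le> norm w" by blast
  have "path_connected C"
    using \<open>open C\<close> by (rule connected_open_path_connected) (simp add: C_def)
  then obtain \<sigma> where "path \<sigma>" "path_image \<sigma> \<subseteq> C" "pathstart \<sigma> = 0" "pathfinish \<sigma> = w"
    using \<open>0 \<in> C\<close> w(1) unfolding path_connected_def by blast
  then show thesis
    using CS w(2) by (intro that[of \<sigma>]) (auto simp: S_def)
qed

text \<open>Equal moduli and equal real parts leave only the sign of the imaginary part free, so the
  \<open>N\<close>-th powers agree up to conjugation; the quotient is then a root of unity.\<close>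

lemma dihedral_orbit:
  fixes z w :: complex
  assumes N: "0 < N" and w: "w \<noteq> 0" and nrm: "norm z = norm w" and re: "Re (z ^ N) = Re (w ^ N)"
  obtains u where "u ^ N = 1" "z = u * w \<or> z = cnj (u * w)"
proof -
  have "norm (z ^ N) = norm (w ^ N)" using nrm by (simp add: norm_power)
  then have "Im (z ^ N) ^ 2 = Im (w ^ N) ^ 2"
    using re unfolding cmod_def by simp
  then have "Im (z ^ N) = Im (w ^ N) \<or> Im (z ^ N) = - Im (w ^ N)"
    by (simp add: power2_eq_iff)
  then have "z ^ N = w ^ N \<or> z ^ N = cnj w ^ N"
    using re by (simp add: complex_eq_iff flip: complex_cnj_power)
  then show thesis
  proof
    assume "z ^ N = w ^ N"
    then show thesis using w by (intro that[of "z / w"]) (auto simp: power_divide)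
  next
    assume "z ^ N = cnj w ^ N"
    then have "cnj z ^ N = w ^ N" by (metis complex_cnj_cnj complex_cnj_power)
    then show thesis using w by (intro that[of "cnj z / w"]) (auto simp: power_divide)
  qed
qed

lemma paths_meet_dihedral:
  fixes \<gamma> \<sigma> :: "real \<Rightarrow> complex"
  assumes N: "0 < N" and r: "0 < r"
    and \<gamma>: "path \<gamma>" "\<And>z. z \<in> path_image \<gamma> \<Longrightarrow> r < norm z \<and> norm z < R"
    and ends: "Re (pathstart \<gamma> ^ N) = - (norm (pathstart \<gamma>) ^ N)"
              "Re (pathfinish \<gamma> ^ N) = norm (pathfinish \<gamma>) ^ N"
    and \<sigma>: "path \<sigma>" "norm (pathstart \<sigma>) \<le> r" "R \<le> norm (pathfinish \<sigma>)"
  obtains z w where "z \<in> path_image \<gamma>" "w \<in> path_image \<sigma>" "norm z = norm w" "Re (z ^ N) = Re (w ^ N)"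
proof -
  txt \<open>
    Modulo the dihedral group of order \<open>2N\<close> a point is given by the cosine of \<open>N\<close> times its argument
    and by its modulus. In these coordinates the two paths cross a rectangle in the two directions.
    Truncating the modulus keeps the coordinates continuous at the origin and does not affect
    the values on \<open>\<gamma>\<close>.
  \<close>
  define p :: "complex \<Rightarrow> real" where "p z = Re (z ^ N) / max r (norm z) ^ N" for z
  define q :: "complex \<Rightarrow> real" where "q z = max r (min R (norm z))" for z
  define \<Phi> :: "complex \<Rightarrow> real^2" where "\<Phi> z = (\<chi> i. if i = 1 then p z else q z)" for z
  have \<Phi>: "\<Phi> z $ 1 = p z" "\<Phi> z $ 2 = q z" for z by (simp_all add: \<Phi>_def)
  have rR: "r < R" using \<gamma>(2)[OF pathstart_in_path_image] by linarith
  have mpos: "0 < max r (norm z) ^ N" for z :: complex using r by simp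
  have cont: "continuous_on UNIV \<Phi>"
    unfolding \<Phi>_def
  proof (rule continuous_on_vec_lambda)
    fix i :: 2
    have "continuous_on UNIV p"
      unfolding p_def by (intro continuous_intros) (use mpos in \<open>metis less_irrefl\<close>)
    moreover have "continuous_on UNIV q"
      unfolding q_def by (intro continuous_intros)
    ultimately show "continuous_on UNIV (\<lambda>z. if i = 1 then p z else q z)"
      by (cases "i = 1") auto
  qed
  have p1: "\<bar>p z\<bar> \<le> 1" for z
  proof -
    have "\<bar>Re (z ^ N)\<bar> \<le> norm z ^ N"
      using abs_Re_le_cmod[of "z ^ N"] by (simp add: norm_power)
    also have "\<dots> \<le> max r (norm z) ^ N" by (intro power_mono) auto
    finally show ?thesis using mpos[of z] by (simp add: p_def abs_divide)
  qed
  define a b :: "real^2" where "a = (\<chi> i. if i = 1 then -1 else r)" and "b = (\<chi> i. if i = 1 then 1 else R)"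
  have box: "\<Phi> z \<in> cbox a b" for z
    using p1[of z] rR
    by (auto simp: mem_box_cart a_def b_def \<Phi>_def q_def abs_le_iff)
  have path\<Phi>: "path (\<Phi> \<circ> g)" if "path g" for g
    using that cont by (intro path_continuous_image) (auto intro: continuous_on_subset)
  have exact: "p z = Re (z ^ N) / norm z ^ N" "q z = norm z" if "z \<in> path_image \<gamma>" for z
    using \<gamma>(2)[OF that] by (auto simp: p_def q_def)
  have nz: "0 < norm z ^ N" if "z \<in> path_image \<gamma>" for z
    using \<gamma>(2)[OF that] r by (intro zero_less_power) linarith
  have nz0: "z \<noteq> 0" if "z \<in> path_image \<gamma>" for z
    using \<gamma>(2)[OF that] r by auto
  \<comment> \<open>The end conditions say that the cosine coordinate of \<open>\<gamma>\<close>
    runs from -1 to 1, while the truncated modulus of \<open>\<sigma>\<close> runs from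
    \<open>r\<close> to \<open>R\<close>. These are opposite sides of the box, as
    \<open>fashoda\<close> requires.\<close>
  have s: "(pathstart (\<Phi> \<circ> \<gamma>)) $ 1 = a $ 1"
    using exact(1)[OF pathstart_in_path_image] ends(1) nz0[OF pathstart_in_path_image]
    by (simp add: pathstart_compose \<Phi> a_def)
  have f: "(pathfinish (\<Phi> \<circ> \<gamma>)) $ 1 = b $ 1"
    using exact(1)[OF pathfinish_in_path_image] ends(2) nz0[OF pathfinish_in_path_image]
    by (simp add: pathfinish_compose \<Phi> b_def)
  have s2: "(pathstart (\<Phi> \<circ> \<sigma>)) $ 2 = a $ 2"
    using \<sigma>(2) rR by (simp add: pathstart_compose \<Phi> a_def q_def)
  have f2: "(pathfinish (\<Phi> \<circ> \<sigma>)) $ 2 = b $ 2"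
    using \<sigma>(3) rR by (simp add: pathfinish_compose \<Phi> b_def q_def)
  obtain v where "v \<in> path_image (\<Phi> \<circ> \<gamma>)" "v \<in> path_image (\<Phi> \<circ> \<sigma>)"
    using fashoda[OF path\<Phi>[OF \<gamma>(1)] path\<Phi>[OF \<sigma>(1)] _ _ s f s2 f2] box
    by (auto simp: path_image_compose image_subset_iff)
  then obtain z w where zw: "z \<in> path_image \<gamma>" "w \<in> path_image \<sigma>" "\<Phi> z = \<Phi> w"
    by (auto simp: path_image_compose)
  have pq: "p z = p w" "q z = q w" using zw(3) \<Phi> by metis+
  \<comment> \<open>The modulus on \<open>\<gamma>\<close> lies strictly between \<open>r\<close>
    and \<open>R\<close>, so equality of the truncated values means that neither point was
    truncated.\<close>
  have "q w = norm w" "norm z = norm w"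
    using pq(2) exact(2)[OF zw(1)] \<gamma>(2)[OF zw(1)] unfolding q_def by (auto simp: max_def min_def split: if_splits)
  moreover have "max r (norm w) = norm w" using \<gamma>(2)[OF zw(1)] calculation by simp
  ultimately have "Re (z ^ N) = Re (w ^ N)"
    using pq(1) nz0[OF zw(1)] exact(1)[OF zw(1)] by (auto simp: p_def)
  then show thesis using that zw \<open>norm z = norm w\<close> by blast
qed

lemma koebe_arc_bound:
  fixes f :: "complex \<Rightarrow> complex"
  assumes holf: "f holomorphic_on ball 0 1" and M: "\<And>z. z \<in> ball 0 1 \<Longrightarrow> norm (f z) \<le> M"
    and N: "0 < N" and r: "0 < r"
    and \<gamma>: "path \<gamma>" "path_image \<gamma> \<subseteq> ball 0 1" "\<And>z. z \<in> path_image \<gamma> \<Longrightarrow> r < norm z"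
    and small: "\<And>z. z \<in> path_image \<gamma> \<Longrightarrow> norm (f z) \<le> \<eta>"
    and ends: "Re (pathstart \<gamma> ^ N) = - (norm (pathstart \<gamma>) ^ N)"
              "Re (pathfinish \<gamma> ^ N) = norm (pathfinish \<gamma>) ^ N"
  shows "norm (f 0) ^ (2 * N) \<le> \<eta> * M ^ (2 * N - 1)"
proof (rule ccontr)
  assume contra: "\<not> ?thesis"
  txt \<open>
    The product \<open>G\<close> of the copies of \<open>f\<close> under the dihedral group is small on the orbit of \<open>\<gamma>\<close>, while
    it is large on a path from the origin to the vicinity of the circle, which must meet this orbit.
  \<close>
  define U :: "complex set" where "U = {u. u ^ N = 1}"
  have finU: "finite U" and cardU: "card U = N"
    using N finite_roots_unity[of N] card_roots_unity_eq[of N] by (auto simp: U_def)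
  have U1: "norm u = 1" if "u \<in> U" for u
    using that N power_eq_1_iff[of u N] unfolding U_def by auto
  have UD: "u * w \<in> ball 0 1" "cnj (u * w) \<in> ball 0 1" if "u \<in> U" "w \<in> ball 0 1" for u w
    using that U1 by (auto simp: norm_mult)
  have M0: "0 \<le> M" using M[of 0] norm_ge_zero[of "f 0"] by (simp del: norm_ge_zero)
  \<comment> \<open>Pairing \<open>f\<close> with its reflection keeps the factor holomorphic, and
    the product over \<open>N\<close> rotations then has \<open>2 * N\<close> factors. One of them
    will be at most \<open>\<eta>\<close>, the others at most \<open>M\<close>.\<close>
  define g where "g z = f z * cnj (f (cnj z))" for z
  have cnjball: "cnj ` ball 0 1 = ball 0 1"
    by (auto simp: image_cnj_conv_vimage_cnj)
  have "(cnj \<circ> f \<circ> cnj) holomorphic_on ball 0 1"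
    by (rule holomorphic_on_compose_cnj_cnj) (simp_all add: cnjball holf)
  then have holg: "g holomorphic_on ball 0 1"
    unfolding g_def using holf by (auto intro!: holomorphic_intros simp: o_def)
  define G where "G w = (\<Prod>u\<in>U. g (u * w))" for w
  have "(\<lambda>w. g (u * w)) holomorphic_on ball 0 1" if "u \<in> U" for u
  proof -
    have "g \<circ> (\<lambda>w. u * w) holomorphic_on ball 0 1"
      by (rule holomorphic_on_compose_gen[OF _ holg]) (use UD that in \<open>auto intro!: holomorphic_intros\<close>)
    then show ?thesis by (simp add: o_def)
  qed
  then have holG: "G holomorphic_on ball 0 1"
    unfolding G_def by (rule holomorphic_on_prod)
  have G0: "norm (G 0) = norm (f 0) ^ (2 * N)"
    by (simp add: G_def g_def norm_power norm_mult cardU power2_eq_square power_mult)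
  obtain R where R: "0 < R" "R < 1" "\<And>z. z \<in> path_image \<gamma> \<Longrightarrow> norm z < R"
  proof -
    obtain z0 where z0: "z0 \<in> path_image \<gamma>" "\<And>z. z \<in> path_image \<gamma> \<Longrightarrow> norm z \<le> norm z0"
      using continuous_attains_sup[OF compact_path_image[OF \<gamma>(1)] path_image_nonempty, of norm]
      by (auto intro: continuous_intros)
    have "norm z0 < 1" using z0(1) \<gamma>(2) by auto
    then have "norm z < (norm z0 + 1) / 2" if "z \<in> path_image \<gamma>" for z
      using z0(2)[OF that] by (simp add: field_simps)
    then show thesis
      using \<open>norm z0 < 1\<close> by (intro that[of "(norm z0 + 1) / 2"]) (auto intro: add_nonneg_pos)
  qed
  obtain \<sigma> where \<sigma>: "path \<sigma>" "path_image \<sigma> \<subseteq> ball 0 1" "pathstart \<sigma> = 0" "R \<le> norm (pathfinish \<sigma>)"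
    "\<And>w. w \<in> path_image \<sigma> \<Longrightarrow> \<eta> * M ^ (2 * N - 1) < norm (G w)"
    \<comment> \<open>The negated claim is exactly the assertion that the modulus of
      \<open>G\<close> at the origin exceeds the level.\<close>
    using superlevel_path[OF holG _ R(1,2)] contra unfolding G0 not_le by metis
  obtain z w where zw: "z \<in> path_image \<gamma>" "w \<in> path_image \<sigma>" "norm z = norm w" "Re (z ^ N) = Re (w ^ N)"
    using paths_meet_dihedral[OF N r \<gamma>(1) _ ends \<sigma>(1) _ \<sigma>(4)] \<gamma>(3) R(3) \<sigma>(3) r by (metis norm_zero less_imp_le)
  have w: "w \<in> ball 0 1" "w \<noteq> 0" using zw \<sigma>(2) \<gamma>(3)[OF zw(1)] r by auto
  obtain u where u: "u \<in> U" "z = u * w \<or> z = cnj (u * w)"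
    using dihedral_orbit[OF N w(2) zw(3,4)] unfolding U_def by auto
  have gM: "norm (g (v * w)) \<le> M\<^sup>2" if "v \<in> U" for v
    using UD[OF that w(1)] M M0 by (auto simp: g_def norm_mult power2_eq_square simp del: complex_cnj_mult intro!: mult_mono)
  have \<eta>0: "0 \<le> \<eta>" using small[OF zw(1)] norm_ge_zero order_trans by blast
  \<comment> \<open>The point \<open>z\<close> on the arc is the argument of one of the two factors
    of \<open>g (u * w)\<close>, whichever alternative holds for \<open>u\<close>.\<close>
  have "norm (g (u * w)) \<le> \<eta> * M"
  proof -
    have "norm (f (u * w)) \<le> \<eta> \<or> norm (f (cnj (u * w))) \<le> \<eta>"
      using u(2) small[OF zw(1)] by auto
    moreover have "norm (f (u * w)) \<le> M" "norm (f (cnj (u * w))) \<le> M"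
      using UD[OF u(1) w(1)] M by auto
    ultimately show ?thesis
      using \<eta>0 M0 mult_mono[of "norm (f (u * w))" \<eta> "norm (f (cnj (u * w)))" M]
        mult_mono[of "norm (f (u * w))" M "norm (f (cnj (u * w)))" \<eta>]
      by (auto simp: g_def norm_mult mult.commute simp del: complex_cnj_mult)
  qed
  moreover have "(\<Prod>v\<in>U - {u}. norm (g (v * w))) \<le> (\<Prod>v\<in>U - {u}. M\<^sup>2)"
    by (rule prod_mono) (use gM in auto)
  ultimately have "norm (g (u * w)) * (\<Prod>v\<in>U - {u}. norm (g (v * w))) \<le> (\<eta> * M) * (\<Prod>v\<in>U - {u}. M\<^sup>2)"
    using \<eta>0 M0 by (intro mult_mono) (auto intro: prod_nonneg)
  moreover have "norm (G w) = norm (g (u * w)) * (\<Prod>v\<in>U - {u}. norm (g (v * w)))"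
    unfolding G_def prod_norm[symmetric] using finU u(1) by (rule prod.remove)
  moreover have "(\<eta> * M) * (\<Prod>v\<in>U - {u}. M\<^sup>2) = \<eta> * M ^ (2 * N - 1)"
  proof -
    have "Suc (2 * (N - 1)) = 2 * N - 1" using N by simp
    moreover have "card (U - {u}) = N - 1" using u(1) finU cardU by simp
    ultimately show ?thesis by (simp flip: power_mult power_Suc add: mult.assoc)
  qed
  ultimately show False using \<sigma>(5)[OF zw(2)] by linarith
qed

subsection \<open>Integrals along orbits\<close>

text \<open>Morera's theorem with the order of integration exchanged: on the convex set
  \<open>S\<close> each \<open>f t\<close> has a primitive, so its integrals round a triangle cancel
  for every fixed \<open>t\<close>.\<close>

lemma holomorphic_on_integral_param:
  fixes f :: "real \<Rightarrow> complex \<Rightarrow> complex"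
  assumes "a < b" and S: "open S" "convex S"
    and cont: "continuous_on ({a..b} \<times> S) (\<lambda>(t, z). f t z)"
    and hol: "\<And>t. t \<in> {a..b} \<Longrightarrow> f t holomorphic_on S"
  shows "(\<lambda>z. integral {a..b} (\<lambda>t. f t z)) holomorphic_on S"
proof -
  \<comment> \<open>Recasting the real integral as a contour integral over a real segment turns the
    exchange into a swap of two contour integrals.\<close>
  let ?h = "linepath (of_real a) (of_real b) :: real \<Rightarrow> complex"
  define A where "A z = integral {a..b} (\<lambda>t. f t z)" for z
  have A: "A z = contour_integral ?h (\<lambda>w. f (Re w) z)" for z
    using \<open>a < b\<close> contour_integral_linepath_Reals_eq[of "of_real a" "of_real b" "\<lambda>w. f (Re w) z"]
    by (simp add: A_def)
  have Re_h: "Re w \<in> {a..b}" if "w \<in> path_image ?h" for w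
    using that \<open>a < b\<close> by (auto simp: closed_segment_of_real closed_segment_eq_real_ivl)
  have cont': "continuous_on (T \<times> path_image ?h) (\<lambda>(z, w). f (Re w) z)" if "T \<subseteq> S" for T
  proof -
    have "continuous_on (T \<times> path_image ?h) ((\<lambda>(t, z). f t z) \<circ> (\<lambda>(z, w). (Re w, z)))"
    proof (rule continuous_on_compose)
      show "continuous_on (T \<times> path_image ?h) (\<lambda>(z, w). (Re w, z))"
        by (auto simp: case_prod_unfold intro!: continuous_intros)
      show "continuous_on ((\<lambda>(z, w). (Re w, z)) ` (T \<times> path_image ?h)) (\<lambda>(t, z). f t z)"
        using cont by (rule continuous_on_subset) (use Re_h that in auto)
    qed
    then show ?thesis by (simp add: o_def case_prod_unfold)
  qed
  have "continuous_on S A"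
  proof -
    have "continuous_on (S \<times> {a..b}) ((\<lambda>(t, z). f t z) \<circ> prod.swap)"
      by (rule continuous_on_compose) (auto intro: continuous_on_swap simp: product_swap cont)
    then show ?thesis
      unfolding A_def box_real(2)[symmetric]
      by (intro integral_continuous_on_param) (simp add: o_def case_prod_unfold prod.swap_def)
  qed
  moreover have "contour_integral (linepath x y) A + contour_integral (linepath y z) A
      + contour_integral (linepath z x) A = 0" if hull: "convex hull {x, y, z} \<subseteq> S" for x y z
  proof -
    define I where "I u v w = contour_integral (linepath u v) (f (Re w))" for u v w
    have swap: "contour_integral (linepath u v) A = contour_integral ?h (I u v)"
      and int: "I u v contour_integrable_on ?h" if "closed_segment u v \<subseteq> S" for u v
    proof -
      show "contour_integral (linepath u v) A = contour_integral ?h (I u v)"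
        unfolding A I_def
        by (rule contour_integral_swap) (use cont'[OF that] in auto)
      have "continuous_on (path_image ?h \<times> {0..1}) (\<lambda>(w, t). f (Re w) (linepath u v t))"
      proof -
        have "continuous_on (path_image ?h \<times> {0..1}) ((\<lambda>(t, z). f t z) \<circ> (\<lambda>(w, t). (Re w, linepath u v t)))"
        proof (rule continuous_on_compose)
          show "continuous_on (path_image ?h \<times> {0..1}) (\<lambda>(w, t). (Re w, linepath u v t))"
            by (auto simp: case_prod_unfold linepath_def intro!: continuous_intros)
          show "continuous_on ((\<lambda>(w, t). (Re w, linepath u v t)) ` (path_image ?h \<times> {0..1})) (\<lambda>(t, z). f t z)"
            using cont by (rule continuous_on_subset) 
              (use Re_h that linepath_in_path[of _ u v] in auto)
        qed
        then show ?thesis by (simp add: o_def case_prod_unfold)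
      qed
      then have "continuous_on (path_image ?h \<times> {0..1}) (\<lambda>(w, t). f (Re w) (linepath u v t) * (v - u))"
        by (simp add: case_prod_unfold continuous_on_mult_right)
      then have "continuous_on (path_image ?h) (\<lambda>w. integral (cbox 0 1) (\<lambda>t. f (Re w) (linepath u v t) * (v - u)))"
        by (intro integral_continuous_on_param) simp
      then have "continuous_on (path_image ?h) (I u v)"
        by (simp add: I_def[abs_def] contour_integral_integral)
      then show "I u v contour_integrable_on ?h"
        by (intro contour_integrable_continuous_linepath) simp
    qed
    have seg: "closed_segment x y \<subseteq> S" "closed_segment y z \<subseteq> S" "closed_segment z x \<subseteq> S"
      using hull by (meson closed_segment_subset convex_convex_hull hull_inc insertI1 insertI2 order_trans)+
    have "contour_integral (linepath x y) A + contour_integral (linepath y z) A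
      + contour_integral (linepath z x) A = contour_integral ?h (\<lambda>w. I x y w + I y z w + I z x w)"
      using seg by (simp add: swap int contour_integral_add contour_integrable_add)
    also have "\<dots> = contour_integral ?h (\<lambda>w. 0)"
    proof (rule contour_integral_cong[OF refl])
      fix w assume "w \<in> path_image ?h"
      then obtain F where F: "\<And>v. v \<in> S \<Longrightarrow> (F has_field_derivative f (Re w) v) (at v within S)"
        using holomorphic_convex_primitive'[OF S(2,1) hol] Re_h by blast
      have "I u v w = F v - F u" if "closed_segment u v \<subseteq> S" for u v
        unfolding I_def using contour_integral_primitive[of S F, OF F, of "linepath u v"] that
        by (auto intro: contour_integral_unique)
      then show "I x y w + I y z w + I z x w = 0" using seg by simp
    qed
    finally show ?thesis by simp
  qed
  ultimately have "A analytic_on S"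
    using \<open>open S\<close> by (intro Morera_triangle) auto
  then show ?thesis unfolding A_def[abs_def] by (rule analytic_imp_holomorphic)
qed

section \<open>Elementary estimates for the semigroup and its time averages\<close>

lemma semigroup_bound:
  assumes "holomorphic_semigroup \<phi>" "0 \<le> t" "z \<in> ball 0 1"
  shows "norm (\<phi> t z) < 1"
  using assms unfolding holomorphic_semigroup_def by (force simp: image_subset_iff)

lemma semigroup_continuous:
  assumes "holomorphic_semigroup \<phi>" "z \<in> ball 0 1"
  shows "continuous_on {0..} (\<lambda>t. \<phi> t z)"
proof -
  have "continuous_on {0..} ((\<lambda>(t, z). \<phi> t z) \<circ> (\<lambda>t. (t, z)))"
    using assms by (intro continuous_on_compose)
      (auto simp: holomorphic_semigroup_def intro!: continuous_intros elim!: continuous_on_subset)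
  then show ?thesis by (simp add: o_def)
qed

text \<open>Joint continuity is uniform on the compact set \<open>{0..1} \<times> cball 0 r\<close>;
  comparing time \<open>s\<close> with time 0 gives a bound independent of \<open>z\<close>.\<close>

lemma semigroup_near_identity:
  assumes sg: "holomorphic_semigroup \<phi>" and "r < 1" "0 < e"
  obtains d where "0 < d" "\<And>s z. 0 \<le> s \<Longrightarrow> s \<le> d \<Longrightarrow> z \<in> cball 0 r \<Longrightarrow> norm (\<phi> s z - z) \<le> e"
proof -
  have "uniformly_continuous_on ({0..1} \<times> cball 0 r) (\<lambda>(t, z). \<phi> t z)"
  proof (rule compact_uniformly_continuous)
    show "continuous_on ({0..1} \<times> cball 0 r) (\<lambda>(t, z). \<phi> t z)"
      using sg \<open>r < 1\<close> unfolding holomorphic_semigroup_def by (auto elim!: continuous_on_subset)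
  qed (simp add: compact_Times)
  then obtain d where d: "0 < d" "\<And>x y. x \<in> {0..1} \<times> cball 0 r \<Longrightarrow> y \<in> {0..1} \<times> cball 0 r \<Longrightarrow>
      dist y x < d \<Longrightarrow> dist (case y of (t, z) \<Rightarrow> \<phi> t z) (case x of (t, z) \<Rightarrow> \<phi> t z) < e"
    using \<open>0 < e\<close> unfolding uniformly_continuous_on_def by metis
  show thesis
  proof (rule that[of "min 1 (d / 2)"])
    fix s z assume s: "0 \<le> s" "s \<le> min 1 (d / 2)" and z: "z \<in> cball (0::complex) r"
    have "\<phi> 0 z = z"
      using sg z \<open>r < 1\<close> unfolding holomorphic_semigroup_def by auto
    moreover have "dist (s, z) (0, z) < d"
      using s d(1) by (simp add: dist_Pair_Pair)
    ultimately show "norm (\<phi> s z - z) \<le> e"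
      using d(2)[of "(0, z)" "(s, z)"] s z by (simp add: dist_norm)
  qed (use d(1) in simp)
qed

text \<open>This is the function \<open>A\<close> of the overview. Orbits are only given as
  continuous in time; averaging over a time window produces a function that is Lipschitz along
  them.\<close>

definition orbit_integral :: "(real \<Rightarrow> complex \<Rightarrow> complex) \<Rightarrow> real \<Rightarrow> complex \<Rightarrow> complex" where
  "orbit_integral \<phi> d z = integral {0..d} (\<lambda>s. \<phi> s z)"

context
  fixes \<phi> :: "real \<Rightarrow> complex \<Rightarrow> complex" and d :: real
  assumes sg: "holomorphic_semigroup \<phi>" and d: "0 < d"
begin

lemma holomorphic_orbit_integral: "orbit_integral \<phi> d holomorphic_on ball 0 1"
  unfolding orbit_integral_def
  by (rule holomorphic_on_integral_param)
     (use sg d in \<open>auto simp: holomorphic_semigroup_def elim!: continuous_on_subset\<close>)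

lemma norm_orbit_integral_le:
  assumes "z \<in> ball 0 1"
  shows "norm (orbit_integral \<phi> d z) \<le> d"
proof -
  have "continuous_on {0..d} (\<lambda>s. \<phi> s z)"
    using semigroup_continuous[OF sg assms] by (rule continuous_on_subset) auto
  then have "norm (integral {0..d} (\<lambda>s. \<phi> s z)) \<le> 1 * (d - 0)"
    using d semigroup_bound[OF sg _ assms] by (intro integral_bound) (auto intro: less_imp_le)
  then show ?thesis by (simp add: orbit_integral_def)
qed

text \<open>By the semigroup law, moving along the orbit for time \<open>t\<close> shifts the window
  from \<open>{0..d}\<close> to \<open>{t..d + t}\<close>. The difference consists of two integrals
  over intervals of length \<open>t\<close>, with integrand of modulus below 1.\<close>

lemma norm_orbit_integral_shift_le:
  assumes "0 \<le> t" "z \<in> ball 0 1"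
  shows "norm (orbit_integral \<phi> d (\<phi> t z) - orbit_integral \<phi> d z) \<le> 2 * t"
proof -
  define J where "J a b = integral {a..b} (\<lambda>s. \<phi> s z)" for a b
  have cont: "continuous_on {a..b} (\<lambda>s. \<phi> s z)" if "0 \<le> a" for a b
    using semigroup_continuous[OF sg assms(2)] by (rule continuous_on_subset) (use that in auto)
  have J: "norm (J a b) \<le> b - a" if "0 \<le> a" "a \<le> b" for a b
    using integral_bound[OF that(2) cont[OF that(1)], of 1] semigroup_bound[OF sg _ assms(2)] that
    by (simp add: J_def less_imp_le)
  \<comment> \<open>Both cuts are made in the whole interval up to \<open>d + t\<close>, so the
    identity also covers disjoint windows.\<close>
  have split: "J 0 c + J c (d + t) = J 0 (d + t)" if "0 \<le> c" "c \<le> d + t" for c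
    unfolding J_def using that by (intro Henstock_Kurzweil_Integration.integral_combine integrable_continuous_real cont) auto
  have "orbit_integral \<phi> d (\<phi> t z) = integral {0..d} (\<lambda>s. \<phi> (s + t) z)"
    unfolding orbit_integral_def
    by (rule Henstock_Kurzweil_Integration.integral_cong) (use sg assms in \<open>auto simp: holomorphic_semigroup_def\<close>)
  also have "\<dots> = J t (d + t)"
    using integral_shift_real_ivl[of t t "d + t" "\<lambda>s. \<phi> s z"] by (simp add: J_def)
  finally have "orbit_integral \<phi> d (\<phi> t z) - orbit_integral \<phi> d z = J t (d + t) - J 0 d"
    by (simp add: J_def orbit_integral_def)
  also have "\<dots> = J d (d + t) - J 0 t"
    using split[of t] split[of d] assms d by (simp add: algebra_simps)
  also have "norm \<dots> \<le> norm (J d (d + t)) + norm (J 0 t)" by (rule norm_triangle_ineq4)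
  also have "\<dots> \<le> 2 * t" using J[of d "d + t"] J[of 0 t] assms d by simp
  finally show ?thesis .
qed

lemma orbit_integral_near_identity:
  assumes "z \<in> ball 0 1" and "\<And>s. 0 \<le> s \<Longrightarrow> s \<le> d \<Longrightarrow> norm (\<phi> s z - z) \<le> e"
  shows "norm (orbit_integral \<phi> d z - of_real d * z) \<le> e * d"
proof -
  have cont: "continuous_on {0..d} (\<lambda>s. \<phi> s z)"
    using semigroup_continuous[OF sg assms(1)] by (rule continuous_on_subset) auto
  have "orbit_integral \<phi> d z - of_real d * z = integral {0..d} (\<lambda>s. \<phi> s z - z)"
    using d cont by (simp add: orbit_integral_def integral_diff integrable_continuous_real scaleR_conv_of_real)
  also have "norm \<dots> \<le> e * (d - 0)"
    using d assms(2) cont by (intro integral_bound continuous_intros) auto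
  finally show ?thesis by simp
qed

end

text \<open>On a compact part of the disc \<open>orbit_integral\<close> is close to multiplication
  by \<open>d\<close>, so its small change along the orbit controls the displacement itself. The
  distance from \<open>\<phi> s z\<close> is continuous in time and never equals \<open>k\<close>,
  hence stays below \<open>k\<close> both before and after time \<open>s\<close>.\<close>

lemma orbit_staying_inside:
  assumes sg: "holomorphic_semigroup \<phi>" and "0 \<le> r" "r < 1" "0 < e"
  obtains \<tau> where "0 < \<tau>" "\<And>s t z. 0 \<le> s \<Longrightarrow> s \<le> t \<Longrightarrow> t \<le> \<tau> \<Longrightarrow> z \<in> ball 0 1 \<Longrightarrow>
     norm (\<phi> s z) \<le> r \<Longrightarrow> norm (\<phi> t z - z) < e"
proof -
  \<comment> \<open>The \<open>k\<close>-neighbourhood of \<open>cball 0 r\<close> remains in a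
    compact part of the disc, and two displacements below \<open>k\<close> add up to less than
    \<open>e\<close>.\<close>
  define k where "k = min (e / 2) ((1 - r) / 2)"
  have k: "0 < k" "k \<le> e / 2" "r + k < 1" using assms by (auto simp: k_def min_def field_simps)
  have "0 < k / 8" using k by simp
  then obtain d where d: "0 < d" "\<And>s z. 0 \<le> s \<Longrightarrow> s \<le> d \<Longrightarrow> z \<in> cball 0 (r + k) \<Longrightarrow> norm (\<phi> s z - z) \<le> k / 8"
    using semigroup_near_identity[OF sg k(3), of "k / 8"] by metis
  let ?A = "orbit_integral \<phi> d"
  show thesis
  proof (rule that[of "d * k / 16"])
    show "0 < d * k / 16" using d k by simp
    fix s t z assume st: "0 \<le> s" "s \<le> t" "t \<le> d * k / 16" and z: "z \<in> ball (0::complex) 1"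
      and r: "norm (\<phi> s z) \<le> r"
    define u where "u x = norm (\<phi> x z - \<phi> s z)" for x
    \<comment> \<open>At distance exactly \<open>k\<close>, four errors of at most
      \<open>d * k / 8\<close> would bound \<open>d * k\<close> by \<open>d * k / 2\<close>: two
      from replacing \<open>?A w\<close> by \<open>d\<close> times \<open>w\<close>, two from the
      change of \<open>?A\<close> along the orbit. The latter is where the time bound
      \<open>d * k / 16\<close> comes from.\<close>
    have ne: "u x \<noteq> k" if x: "0 \<le> x" "x \<le> t" for x
    proof
      assume "u x = k"
      have in_ball: "\<phi> s z \<in> cball 0 (r + k)" "\<phi> x z \<in> cball 0 (r + k)"
        using r k \<open>u x = k\<close> norm_triangle_sub[of "\<phi> x z" "\<phi> s z"] by (auto simp: u_def)
      have near: "norm (?A w - of_real d * w) \<le> k / 8 * d" if "w \<in> cball 0 (r + k)" for w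
        using that k by (intro orbit_integral_near_identity[OF sg d(1)] d(2)) auto
      have shift: "norm (?A (\<phi> y z) - ?A z) \<le> d * k / 8" if "0 \<le> y" "y \<le> t" for y
        using norm_orbit_integral_shift_le[OF sg d(1) that(1) z] st that by linarith
      have "of_real d * (\<phi> x z - \<phi> s z) = (?A (\<phi> x z) - ?A z) - (?A (\<phi> s z) - ?A z)
          - (?A (\<phi> x z) - of_real d * \<phi> x z) + (?A (\<phi> s z) - of_real d * \<phi> s z)"
        by (simp add: algebra_simps)
      also have "norm \<dots> \<le> norm (?A (\<phi> x z) - ?A z) + norm (?A (\<phi> s z) - ?A z)
          + norm (?A (\<phi> x z) - of_real d * \<phi> x z) + norm (?A (\<phi> s z) - of_real d * \<phi> s z)"
        by (meson add_right_mono norm_triangle_ineq norm_triangle_ineq4 order_trans)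
      also have "\<dots> \<le> d * k / 8 + d * k / 8 + k / 8 * d + k / 8 * d"
        using st by (intro add_mono near shift in_ball x) auto
      finally have "d * u x \<le> d * k / 2"
        using d(1) by (simp add: u_def norm_mult)
      then show False using \<open>u x = k\<close> d(1) k(1) by simp
    qed
    have "continuous_on {0..t} (\<lambda>x. \<phi> x z)"
      using semigroup_continuous[OF sg z] by (rule continuous_on_subset) auto
    then have "connected (u ` {0..t})"
      unfolding u_def by (intro connected_continuous_image continuous_intros) auto
    moreover have "0 \<in> u ` {0..t}" using st by (auto simp: u_def intro!: image_eqI[of _ _ s])
    ultimately have less: "u x < k" if "0 \<le> x" "x \<le> t" for x
      using connectedD_interval[of "u ` {0..t}" 0 "u x" k] ne that k(1) by (force simp: not_less)
    have "\<phi> 0 z = z" using sg z unfolding holomorphic_semigroup_def by blast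
    then have "norm (\<phi> t z - z) \<le> u t + u 0"
      unfolding u_def using norm_triangle_ineq4[of "\<phi> t z - \<phi> s z" "z - \<phi> s z"] by simp
    then show "norm (\<phi> t z - z) < e"
      using less[of t] less[of 0] st k by simp
  qed
qed

section \<open>Angular displacement of a path\<close>

lemma norm_cis_diff_le: "norm (cis b - cis a) \<le> \<bar>b - a\<bar>"
proof -
  have "cis b - cis a = cis a * (exp (\<i> * of_real (b - a)) - 1)"
    by (simp add: cis_conv_exp algebra_simps flip: exp_add)
  then have "norm (cis b - cis a) = 2 * \<bar>sin ((b - a) / 2)\<bar>"
    by (simp only: norm_mult norm_cis dist_exp_i_1)
  also have "\<dots> \<le> \<bar>b - a\<bar>"
    using abs_sin_x_le_abs_x[of "(b - a) / 2"] by simp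
  finally show ?thesis .
qed

text \<open>A chord is no longer than its arc, so \<open>N\<close> times a continuous argument
  changes by at least \<open>4 * pi\<close> along the path and takes as values an even and an odd
  multiple of \<open>pi\<close>. Cutting there supplies the end conditions of
  \<open>koebe_arc_bound\<close>.\<close>

lemma path_covers_sector:
  assumes \<gamma>: "path \<gamma>" "0 \<notin> path_image \<gamma>"
    and N: "4 * pi \<le> real N * norm (sgn (pathfinish \<gamma>) - sgn (pathstart \<gamma>))"
  obtains x y where "x \<in> {0..1}" "y \<in> {0..1}"
    "Re (\<gamma> x ^ N) = - (norm (\<gamma> x) ^ N)" "Re (\<gamma> y ^ N) = norm (\<gamma> y) ^ N"
proof -
  obtain L where L: "continuous_on {0..1} L" "\<And>x. x \<in> {0..1} \<Longrightarrow> \<gamma> x = exp (L x)"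
    using continuous_logarithm_on_contractible[of "{0..1}" \<gamma>] \<gamma> convex_imp_contractible[of "{0..1::real}"]
    unfolding path_def path_image_def by (metis convex_real_interval(5) imageI)
  define \<alpha> where "\<alpha> x = real N * Im (L x)" for x
  have sgn: "sgn (\<gamma> x) = cis (Im (L x))" if "x \<in> {0..1}" for x
    by (simp add: L(2)[OF that] sgn_div_norm exp_eq_polar scaleR_conv_of_real norm_mult)
  have Re: "Re (\<gamma> x ^ N) = norm (\<gamma> x) ^ N * cos (\<alpha> x)" if "x \<in> {0..1}" for x
  proof -
    have "\<gamma> x ^ N = (of_real (norm (\<gamma> x)) * sgn (\<gamma> x)) ^ N"
      by (metis scaleR_conv_of_real norm_sgn sgn_div_norm sgn_zero divideR_right mult_zero_right norm_eq_zero of_real_0)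
    also have "\<dots> = of_real (norm (\<gamma> x) ^ N) * cis (\<alpha> x)"
      by (simp add: power_mult_distrib sgn[OF that] Complex.DeMoivre \<alpha>_def)
    finally show ?thesis by simp
  qed
  have "real N * norm (sgn (pathfinish \<gamma>) - sgn (pathstart \<gamma>)) \<le> real N * \<bar>Im (L 1) - Im (L 0)\<bar>"
    by (intro mult_left_mono) (simp_all add: pathfinish_def pathstart_def sgn norm_cis_diff_le)
  also have "\<dots> = \<bar>\<alpha> 1 - \<alpha> 0\<bar>"
    by (simp add: \<alpha>_def abs_mult flip: right_diff_distrib)
  finally have big: "4 * pi \<le> \<bar>\<alpha> 1 - \<alpha> 0\<bar>" using N by simp
  have "connected (\<alpha> ` {0..1})"
    unfolding \<alpha>_def using L(1) by (intro connected_continuous_image continuous_intros) auto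
  then have ivt: "v \<in> \<alpha> ` {0..1}" if "min (\<alpha> 0) (\<alpha> 1) \<le> v" "v \<le> max (\<alpha> 0) (\<alpha> 1)" for v
    using connectedD_interval[of "\<alpha> ` {0..1}" "\<alpha> 0" "\<alpha> 1" v]
      connectedD_interval[of "\<alpha> ` {0..1}" "\<alpha> 1" "\<alpha> 0" v] that
    by (auto simp: min_def max_def split: if_splits)
  define m where "m = min (\<alpha> 0) (\<alpha> 1)"
  \<comment> \<open>The first multiple of \<open>2 * pi\<close> from \<open>m\<close> on is at most
    \<open>m + 2 * pi\<close>, so adding \<open>pi\<close> stays in the range of
    \<open>\<alpha>\<close>.\<close>
  define k where "k = \<lceil>m / (2 * pi)\<rceil>"
  have "m / (2 * pi) \<le> of_int k" "of_int k \<le> m / (2 * pi) + 1"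
    using ceiling_correct[of "m / (2 * pi)"] unfolding k_def by linarith+
  then have "m \<le> 2 * pi * of_int k" "2 * pi * of_int k \<le> m + 2 * pi"
    by (simp_all add: field_simps)
  moreover have "m + 4 * pi \<le> max (\<alpha> 0) (\<alpha> 1)"
    using big by (auto simp: m_def)
  ultimately have "2 * pi * of_int k \<in> \<alpha> ` {0..1}" "2 * pi * of_int k + pi \<in> \<alpha> ` {0..1}"
    using pi_gt_zero by (auto intro!: ivt simp del: pi_gt_zero simp flip: m_def)
  then obtain x y where "x \<in> {0..1}" "y \<in> {0..1}" "\<alpha> y = 2 * pi * of_int k" "\<alpha> x = 2 * pi * of_int k + pi"
    by (metis imageE)
  then show thesis
    using Re[of x] Re[of y] by (intro that[of x y]) simp_all
qed

subsection \<open>Uniform convergence to the identity\<close>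

text \<open>Koebe's theorem enters as an explicit inequality: \<open>N\<close>, \<open>r\<close>,
  \<open>d\<close>, \<open>h\<close>, \<open>M\<close> and \<open>k\<close> are all fixed before
  \<open>t\<close> and \<open>z\<close>, so the resulting time bound is uniform in
  \<open>z\<close>.\<close>

lemma semigroup_uniform_limit:
  assumes sg: "holomorphic_semigroup \<phi>" and e: "0 < e"
  obtains \<tau> where "0 < \<tau>" "\<And>t z. 0 \<le> t \<Longrightarrow> t \<le> \<tau> \<Longrightarrow> z \<in> ball 0 1 \<Longrightarrow> norm (\<phi> t z - z) < e"
proof -
  obtain N :: nat where "8 * pi / e \<le> real N" using real_arch_simple by blast
  then have Ne: "4 * pi \<le> real N * (e / 2)" using e by (simp add: field_simps)
  have "0 < N" using Ne pi_gt_zero by (cases N) auto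
  \<comment> \<open>A point of modulus above \<open>r\<close> is within \<open>e / 8\<close> of its
    radial projection. An orbit arc outside this radius whose ends are at least \<open>e\<close>
    apart thus has projected ends at least \<open>e / 2\<close> apart, which is what
    \<open>N\<close> was chosen for.\<close>
  define r where "r = max (1 / 2) (1 - e / 8)"
  have r: "1 / 2 \<le> r" "1 - e / 8 \<le> r" "r < 1" using e by (auto simp: r_def)
  have "0 \<le> r" using r(1) by simp
  obtain \<tau>1 where \<tau>1: "0 < \<tau>1" "\<And>s t z. 0 \<le> s \<Longrightarrow> s \<le> t \<Longrightarrow> t \<le> \<tau>1 \<Longrightarrow> z \<in> ball 0 1 \<Longrightarrow>
     norm (\<phi> s z) \<le> r \<Longrightarrow> norm (\<phi> t z - z) < e"
    using orbit_staying_inside[OF sg \<open>0 \<le> r\<close> r(3) e] by metis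
  obtain d where d: "0 < d" "\<And>s z. 0 \<le> s \<Longrightarrow> s \<le> d \<Longrightarrow> z \<in> cball 0 (1/2) \<Longrightarrow> norm (\<phi> s z - z) \<le> 1/4"
    using semigroup_near_identity[OF sg, of "1/2" "1/4"] by auto
  define A where "A = orbit_integral \<phi> d"
  have holA: "A holomorphic_on ball 0 1"
    unfolding A_def by (rule holomorphic_orbit_integral[OF sg d(1)])
  \<comment> \<open>The Cauchy estimate on the disc of radius 1/2 places \<open>deriv A 0\<close>
    within \<open>d / 2\<close> of \<open>d\<close>.\<close>
  have A'0: "deriv A 0 \<noteq> 0"
  proof
    assume "deriv A 0 = 0"
    have hol: "(\<lambda>z. A z - of_real d * z) holomorphic_on ball 0 1"
      using holA by (intro holomorphic_intros)
    have "norm ((deriv ^^ 1) (\<lambda>z. A z - of_real d * z) 0) \<le> fact 1 * (1 / 4 * d) / (1 / 2) ^ 1"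
    proof (rule Cauchy_inequality)
      show "(\<lambda>z. A z - of_real d * z) holomorphic_on ball 0 (1 / 2)"
        using hol by (rule holomorphic_on_subset) auto
      show "continuous_on (cball 0 (1 / 2)) (\<lambda>z. A z - of_real d * z)"
        using holomorphic_on_imp_continuous_on[OF hol] by (rule continuous_on_subset) auto
      show "norm (A x - of_real d * x) \<le> 1 / 4 * d" if "norm (0 - x) = 1 / 2" for x
        unfolding A_def using that by (intro orbit_integral_near_identity[OF sg d(1)] d(2)) auto
    qed simp
    moreover have "A field_differentiable at 0"
      using holA by (rule holomorphic_on_imp_differentiable_at) auto
    then have "deriv (\<lambda>z. A z - of_real d * z) 0 = - of_real d"
      using \<open>deriv A 0 = 0\<close> by (subst deriv_diff) (auto intro!: derivative_intros)
    ultimately show False using d(1) by simp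
  qed
  have deriv_diff_A: "deriv (\<lambda>z. A z - A 0) 0 = deriv A 0"
  proof -
    have "A field_differentiable at 0"
      using holA by (rule holomorphic_on_imp_differentiable_at) auto
    then show ?thesis by (subst deriv_diff) auto
  qed
  \<comment> \<open>Koebe's bound concerns the value at the origin, where \<open>A - A 0\<close>
    vanishes; dividing out the simple zero leaves a nonzero value.\<close>
  obtain h where h: "h holomorphic_on ball 0 1" "\<And>z. norm z < 1 \<Longrightarrow> A z - A 0 = z * h z" "h 0 \<noteq> 0"
  proof -
    have "(\<lambda>z. A z - A 0) holomorphic_on ball 0 1" using holA by (intro holomorphic_intros)
    then obtain h where "h holomorphic_on ball 0 1" "\<And>z. norm z < 1 \<Longrightarrow> A z - A 0 = z * h z"
      "deriv (\<lambda>z. A z - A 0) 0 = h 0"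
      using Schwarz3[of "\<lambda>z. A z - A 0" 1] by auto
    then show thesis
      using that A'0 deriv_diff_A by metis
  qed
  have A_le: "norm (A z) \<le> d" if "z \<in> ball 0 1" for z
    unfolding A_def by (rule norm_orbit_integral_le[OF sg d(1) that])
  \<comment> \<open>Compactness bounds \<open>h\<close> near the origin; further out, division by
    \<open>z\<close> costs at most a factor 2.\<close>
  obtain M where M: "0 < M" "\<And>z. z \<in> ball 0 1 \<Longrightarrow> norm (h z) \<le> M"
  proof -
    have "continuous_on (cball 0 (1/2)) h"
      using holomorphic_on_imp_continuous_on[OF h(1)] by (rule continuous_on_subset) auto
    then have "bounded (h ` cball 0 (1/2))"
      by (intro compact_imp_bounded compact_continuous_image) auto
    then obtain B where B: "\<And>z. z \<in> cball 0 (1/2) \<Longrightarrow> norm (h z) \<le> B"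
      unfolding bounded_iff by blast
    have "norm (h z) \<le> 4 * d" if "z \<in> ball 0 1" "1 / 2 < norm z" for z
    proof -
      have "norm z * norm (h z) = norm (A z - A 0)"
        using h(2)[of z] that(1) by (simp add: norm_mult)
      also have "\<dots> \<le> 2 * d"
        using norm_triangle_ineq4[of "A z" "A 0"] A_le[OF that(1)] A_le[of 0] by simp
      finally have "norm z * norm (h z) \<le> 2 * d" .
      moreover have "1 / 2 * norm (h z) \<le> norm z * norm (h z)"
        using that(2) by (intro mult_right_mono) auto
      ultimately show ?thesis by simp
    qed
    then have "norm (h z) \<le> max B (4 * d)" if "z \<in> ball 0 1" for z
      using B[of z] that by (cases "norm z \<le> 1 / 2") (auto simp: le_max_iff_disj)
    then show thesis using d(1) by (intro that[of "max B (4 * d)"]) auto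
  qed
  txt \<open>
    Koebe's bound is used twice: for \<open>A - A z\<close> it shows that \<open>A z\<close> is close to \<open>A 0\<close>, so that \<open>h\<close> is
    small on the arc, and then for \<open>h\<close> it contradicts \<open>h 0 \<noteq> 0\<close>.
  \<close>
  define k where "k = norm (h 0) ^ (2 * N) / (8 * M ^ (2 * N - 1))"
  \<comment> \<open>With the factor 8 in \<open>k\<close> the left side is half of the right
    side.\<close>
  have k: "0 < k" "4 * k * M ^ (2 * N - 1) < norm (h 0) ^ (2 * N)"
    using M(1) h(3) by (auto simp: k_def)
  \<comment> \<open>The three bounds serve in turn to keep the orbit outside radius
    \<open>r\<close>, to make the variation of \<open>A\<close> on the arc at most \<open>k\<close>,
    and to let Koebe's bound bring \<open>A z\<close> within \<open>k\<close> of
    \<open>A 0\<close>.\<close>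
  define \<tau> where "\<tau> = min \<tau>1 (min (k / 2) (k ^ (2 * N) / (2 * (2 * d) ^ (2 * N - 1))))"
  have "0 < \<tau>" using \<tau>1(1) k(1) d(1) by (simp add: \<tau>_def)
  moreover have "norm (\<phi> t z - z) < e" if t: "0 \<le> t" "t \<le> \<tau>" and z: "z \<in> ball 0 1" for t z
  proof (rule ccontr)
    assume far: "\<not> norm (\<phi> t z - z) < e"
    have t': "t \<le> \<tau>1" "2 * t \<le> k" "2 * t * (2 * d) ^ (2 * N - 1) \<le> k ^ (2 * N)"
      using t(2) d(1) by (auto simp: \<tau>_def field_simps)
    have out: "r < norm (\<phi> s z)" if "0 \<le> s" "s \<le> t" for s
      using \<tau>1(2)[OF that t'(1) z] far by (meson not_less)
    define \<gamma> where "\<gamma> x = \<phi> (t * x) z" for x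
    have "path \<gamma>"
      unfolding path_def \<gamma>_def using t
      by (intro continuous_on_compose2[OF semigroup_continuous[OF sg z]] continuous_intros) auto
    have \<gamma>D: "\<gamma> x \<in> ball 0 1" "r < norm (\<gamma> x)" "norm (A (\<gamma> x) - A z) \<le> 2 * t" if "x \<in> {0..1}" for x
    proof -
      have "0 \<le> t * x" "t * x \<le> t" using that t(1) by (auto simp: mult_left_le)
      then show "\<gamma> x \<in> ball 0 1" "r < norm (\<gamma> x)" "norm (A (\<gamma> x) - A z) \<le> 2 * t"
        using semigroup_bound[OF sg _ z] out norm_orbit_integral_shift_le[OF sg d(1) _ z, of "t * x"]
        by (auto simp: \<gamma>_def A_def)
    qed
    have \<phi>0: "\<phi> 0 z = z" using sg z unfolding holomorphic_semigroup_def by blast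
    have "4 * pi \<le> real N * norm (sgn (\<gamma> 1) - sgn (\<gamma> 0))"
    proof -
      have radial: "norm (sgn w - w) \<le> e / 8" if "w \<in> ball 0 1" "r < norm w" for w :: complex
      proof -
        have "w \<noteq> 0" using that(2) \<open>0 \<le> r\<close> by auto
        then have "norm w *\<^sub>R sgn w = w" by (simp add: sgn_div_norm)
        then have "sgn w - w = (1 - norm w) *\<^sub>R sgn w" by (simp add: scaleR_diff_left)
        then have "norm (sgn w - w) = 1 - norm w"
          using that r(1) by (auto simp: norm_sgn)
        then show ?thesis using that r(2) by simp
      qed
      have "\<gamma> 1 - \<gamma> 0 = (sgn (\<gamma> 1) - sgn (\<gamma> 0)) - (sgn (\<gamma> 1) - \<gamma> 1) + (sgn (\<gamma> 0) - \<gamma> 0)"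
        by simp
      also have "norm \<dots> \<le> norm (sgn (\<gamma> 1) - sgn (\<gamma> 0)) + norm (sgn (\<gamma> 1) - \<gamma> 1) + norm (sgn (\<gamma> 0) - \<gamma> 0)"
        by (meson add_right_mono norm_triangle_ineq norm_triangle_ineq4 order_trans)
      also have "\<dots> \<le> norm (sgn (\<gamma> 1) - sgn (\<gamma> 0)) + e / 8 + e / 8"
        by (intro add_mono radial \<gamma>D order_refl) auto
      finally have "e / 2 \<le> norm (sgn (\<gamma> 1) - sgn (\<gamma> 0))"
        using far \<phi>0 e by (simp add: \<gamma>_def)
      then have "real N * (e / 2) \<le> real N * norm (sgn (\<gamma> 1) - sgn (\<gamma> 0))"
        by (rule mult_left_mono) simp
      then show ?thesis using Ne by linarith
    qed
    moreover have "0 \<notin> path_image \<gamma>"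
      using \<gamma>D(2) r(1) unfolding path_image_def by fastforce
    ultimately obtain x y where xy: "x \<in> {0..1}" "y \<in> {0..1}"
      "Re (\<gamma> x ^ N) = - (norm (\<gamma> x) ^ N)" "Re (\<gamma> y ^ N) = norm (\<gamma> y) ^ N"
      using path_covers_sector[OF \<open>path \<gamma>\<close>, of N] unfolding pathstart_def pathfinish_def by metis
    \<comment> \<open>The points \<open>x\<close> and \<open>y\<close> come in no particular order;
      if \<open>y < x\<close>, the subpath runs backwards.\<close>
    define \<beta> where "\<beta> = subpath x y \<gamma>"
    have "path \<beta>" unfolding \<beta>_def by (rule path_subpath[OF \<open>path \<gamma>\<close> xy(1,2)])
    have "path_image \<beta> \<subseteq> \<gamma> ` {0..1}"
      unfolding \<beta>_def path_image_def[symmetric] by (rule path_image_subpath_subset[OF xy(1,2)])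
    then have \<beta>: "path_image \<beta> \<subseteq> ball 0 1" "\<And>w. w \<in> path_image \<beta> \<Longrightarrow> r < norm w"
      "\<And>w. w \<in> path_image \<beta> \<Longrightarrow> norm (A w - A z) \<le> 2 * t"
      using \<gamma>D by blast+
    have ends: "Re (pathstart \<beta> ^ N) = - (norm (pathstart \<beta>) ^ N)"
      "Re (pathfinish \<beta> ^ N) = norm (pathfinish \<beta>) ^ N"
      using xy by (simp_all add: \<beta>_def)
    have "0 < r" using r(1) by simp
    note koebe = koebe_arc_bound[OF _ _ \<open>0 < N\<close> this \<open>path \<beta>\<close> \<beta>(1,2) _ ends]
    have "norm (A 0 - A z) ^ (2 * N) \<le> 2 * t * (2 * d) ^ (2 * N - 1)"
    proof (rule koebe[where f = "\<lambda>w. A w - A z"])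
      show "norm (A w - A z) \<le> 2 * d" if "w \<in> ball 0 1" for w
        using norm_triangle_ineq4[of "A w" "A z"] A_le[OF that] A_le[OF z] by simp
    qed (use holA \<beta>(3) in \<open>auto intro!: holomorphic_intros\<close>)
    also have "\<dots> \<le> k ^ (2 * N)" by (rule t'(3))
    finally have A0z: "norm (A 0 - A z) \<le> k"
      using k(1) \<open>0 < N\<close> by (subst (asm) power_mono_iff) auto
    have "norm (h 0) ^ (2 * N) \<le> 4 * k * M ^ (2 * N - 1)"
    proof (rule koebe[OF h(1) M(2)])
      fix w assume w: "w \<in> path_image \<beta>"
      have "norm w * norm (h w) = norm (A w - A 0)"
        using h(2)[of w] w \<beta>(1) by (auto simp: norm_mult)
      also have "\<dots> \<le> norm (A w - A z) + norm (A 0 - A z)"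
        using norm_triangle_ineq4[of "A w - A z" "A 0 - A z"] by simp
      also have "\<dots> \<le> 2 * k" using \<beta>(3)[OF w] A0z t'(2) by linarith
      finally have "norm w * norm (h w) \<le> 2 * k" .
      moreover have "1 / 2 * norm (h w) \<le> norm w * norm (h w)"
        using \<beta>(2)[OF w] r(1) by (intro mult_right_mono) auto
      ultimately show "norm (h w) \<le> 4 * k" by simp
    qed
    then show False using k(2) by simp
  qed
  ultimately show thesis by (rule that)
qed

subsection \<open>The disc algebra\<close>

text \<open>One direction is uniform continuity on the compact closed disc, the other extension to
  the closure. Afterwards only values inside the disc have to be handled.\<close>

lemma disc_algebra_iff_uniformly_continuous:
  "f \<in> disc_algebra \<longleftrightarrow> f \<in> Hinf \<and> uniformly_continuous_on unit_disc f"
proof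
  assume "f \<in> disc_algebra"
  then obtain g where g: "f \<in> Hinf" "continuous_on (closure unit_disc) g" "\<And>z. z \<in> unit_disc \<Longrightarrow> g z = f z"
    unfolding disc_algebra_def by blast
  have "uniformly_continuous_on unit_disc f"
    unfolding uniformly_continuous_on_def
  proof (intro allI impI)
    fix e :: real assume "0 < e"
    moreover have "uniformly_continuous_on (closure unit_disc) g"
      using g(2) by (rule compact_uniformly_continuous) simp
    ultimately obtain d where "0 < d" and d: "\<forall>x\<in>closure unit_disc. \<forall>y\<in>closure unit_disc.
        dist y x < d \<longrightarrow> dist (g y) (g x) < e"
      unfolding uniformly_continuous_on_def by blast
    then show "\<exists>d>0. \<forall>x\<in>unit_disc. \<forall>y\<in>unit_disc. dist y x < d \<longrightarrow> dist (f y) (f x) < e"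
      using closure_subset[THEN subsetD] by (intro exI[of _ d]) (simp flip: g(3))
  qed
  then show "f \<in> Hinf \<and> uniformly_continuous_on unit_disc f"
    using g(1) by simp
next
  assume f: "f \<in> Hinf \<and> uniformly_continuous_on unit_disc f"
  then obtain g where "uniformly_continuous_on (closure unit_disc) g" "\<And>z. z \<in> unit_disc \<Longrightarrow> f z = g z"
    using uniformly_continuous_on_extension_on_closure by metis
  then show "f \<in> disc_algebra"
    using f uniformly_continuous_imp_continuous unfolding disc_algebra_def by force
qed

text \<open>The maximal subspace is greatest among closed subspaces, so inclusion requires the disc
  algebra itself to be one. Closedness holds because uniform limits preserve uniform
  continuity.\<close>

lemma closed_subspace_disc_algebra: "closed_subspace_Hinf disc_algebra"
  unfolding closed_subspace_Hinf_def
proof (intro conjI ballI allI impI)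
  show "disc_algebra \<subseteq> Hinf" by (auto simp: disc_algebra_def)
  show "(\<lambda>z. 0) \<in> disc_algebra"
    by (simp add: disc_algebra_iff_uniformly_continuous Hinf_zero uniformly_continuous_on_const)
  show "(\<lambda>z. f z + g z) \<in> disc_algebra" if "f \<in> disc_algebra" "g \<in> disc_algebra" for f g
    using that by (simp add: disc_algebra_iff_uniformly_continuous Hinf_add uniformly_continuous_on_add)
  show "(\<lambda>z. c * f z) \<in> disc_algebra" if "f \<in> disc_algebra" for c f
    using that bounded_linear.uniformly_continuous_on[OF bounded_linear_mult_right[of c], of unit_disc f]
    by (simp add: disc_algebra_iff_uniformly_continuous Hinf_scale)
next
  fix F :: "nat \<Rightarrow> complex \<Rightarrow> complex" and f
  assume f: "f \<in> Hinf" and F: "\<forall>n. F n \<in> disc_algebra"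
    and lim: "(\<lambda>n. Hinf_norm (\<lambda>z. F n z - f z)) \<longlonglongrightarrow> 0"
  have "uniformly_continuous_on unit_disc f"
    unfolding uniformly_continuous_on_def
  proof (intro allI impI)
    fix e :: real assume "0 < e"
    then obtain n where n: "Hinf_norm (\<lambda>z. F n z - f z) < e / 3"
      using order_tendstoD(2)[OF lim, of "e / 3"] by (auto simp: eventually_sequentially)
    have Fn: "F n \<in> Hinf" "uniformly_continuous_on unit_disc (F n)"
      using F disc_algebra_iff_uniformly_continuous by blast+
    have near: "dist (F n w) (f w) < e / 3" if "w \<in> unit_disc" for w
      using Hinf_norm_upper[OF Hinf_diff[OF Fn(1) f] that] n by (simp add: dist_norm)
    obtain d where d: "0 < d" "\<And>x y. x \<in> unit_disc \<Longrightarrow> y \<in> unit_disc \<Longrightarrow> dist y x < d \<Longrightarrow> dist (F n y) (F n x) < e / 3"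
      using Fn(2) \<open>0 < e\<close> unfolding uniformly_continuous_on_def by (metis divide_pos_pos zero_less_numeral)
    have "dist (f y) (f x) < e" if "x \<in> unit_disc" "y \<in> unit_disc" "dist y x < d" for x y
      using near[OF that(1)] near[OF that(2)] d(2)[OF that]
        dist_triangle[of "f y" "f x" "F n y"] dist_triangle[of "F n y" "f x" "F n x"]
      by (simp add: dist_commute)
    then show "\<exists>d>0. \<forall>x\<in>unit_disc. \<forall>y\<in>unit_disc. dist y x < d \<longrightarrow> dist (f y) (f x) < e"
      using d(1) by blast
  qed
  then show "f \<in> disc_algebra"
    using f by (simp add: disc_algebra_iff_uniformly_continuous)
qed

theorem corollary1p4:
  fixes \<phi> :: "real \<Rightarrow> complex \<Rightarrow> complex"
  assumes "holomorphic_semigroup \<phi>"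
  shows "disc_algebra \<subseteq> maximal_subspace \<phi>"
proof (rule maximal_subspace_greatest(3)[OF assms closed_subspace_disc_algebra])
  show "strongly_continuous_on \<phi> disc_algebra"
    unfolding strongly_continuous_on_def
  proof (intro ballI tendstoI)
    fix f and e :: real assume f: "f \<in> disc_algebra" and "0 < e"
    then have Hf: "f \<in> Hinf" and "uniformly_continuous_on unit_disc f"
      using disc_algebra_iff_uniformly_continuous by blast+
    then obtain d where d: "0 < d" "\<And>x y. x \<in> unit_disc \<Longrightarrow> y \<in> unit_disc \<Longrightarrow> dist y x < d \<Longrightarrow> dist (f y) (f x) < e / 2"
      using \<open>0 < e\<close> unfolding uniformly_continuous_on_def by (metis half_gt_zero)
    obtain \<tau> where \<tau>: "0 < \<tau>" "\<And>t z. 0 \<le> t \<Longrightarrow> t \<le> \<tau> \<Longrightarrow> z \<in> unit_disc \<Longrightarrow> norm (\<phi> t z - z) < d"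
      using semigroup_uniform_limit[OF assms d(1)] by metis
    have "dist (Hinf_norm (\<lambda>z. comp_op \<phi> t f z - f z)) 0 < e" if t: "0 < t" "t < \<tau>" for t
    proof -
      \<comment> \<open>Passing to the supremum keeps only a weak inequality, hence the target
        \<open>e / 2\<close>.\<close>
      have "Hinf_norm (\<lambda>z. comp_op \<phi> t f z - f z) \<le> e / 2"
      proof (rule Hinf_norm_least)
        fix z assume z: "z \<in> unit_disc"
        have "dist (f (\<phi> t z)) (f z) < e / 2"
          using d(2)[OF z, of "\<phi> t z"] \<tau>(2)[OF _ _ z, of t] semigroup_bound[OF assms _ z, of t] t
          by (simp add: dist_norm)
        then show "norm (comp_op \<phi> t f z - f z) \<le> e / 2"
          by (simp add: comp_op_def dist_norm)
      qed
      moreover have "0 \<le> Hinf_norm (\<lambda>z. comp_op \<phi> t f z - f z)"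
        using Hinf_diff[OF comp_op_Hinf[OF assms _ Hf] Hf] t by (intro Hinf_norm_nonneg) simp
      ultimately show ?thesis using \<open>0 < e\<close> by simp
    qed
    then show "\<forall>\<^sub>F t in at_right 0. dist (Hinf_norm (\<lambda>z. comp_op \<phi> t f z - f z)) 0 < e"
      using \<tau>(1) by (auto simp: eventually_at_right_field)
  qed
qed

end
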